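(* Let $P=(P_1,\dots,P_n)$ be a stratified Datalog program, possibly with generalized literals, $U$ a universe for $P$, and $l$ a ground literal over the predicates of $P$ and the elements of $U$. For the least fixed point model $\mathcal{U}_n$ of $P$ with input $\mathcal{U}=\mathrm{id}(U)$, we have $\mathcal{U}_n\models l$ if and only if there exists an open answer set $(U,M)$ of $P$ such that $M\models l$. Moreover, for any open answer set $(U,M)$ of $P$ (with this universe $U$), $M=\mathcal{U}_n\setminus\mathrm{id}(U)$.
   Context: **Generalized programs and open answer sets.** Terms are constants and variables (no function symbols). A literal is an atom $q(\mathbf{t})$ or a naf-atom $\mathrm{not}\,q(\mathbf{t})$. Equality is a binary predicate; $t\neq s$ stands for $\mathrm{not}\,(t=s)$. A regular atom is an atom that is not an equality atom. A generalized literal here is a formula $\forall\mathbf{Y}.\,a\Rightarrow b$ with $a,b$ atoms. For a set $\beta$ of literals and generalized literals, $\beta^{\mathrm{x}}$ is its set of generalized literals, $\beta^+$ its set of atoms, $\beta^-=\{a\mid\mathrm{not}\,a\in\beta\}$. A universe $U$ for $P$ is a non-empty countable superset of the constants of $P$; $P_U$ is obtained by substituting the (free) variables of rules of $P$ by elements of $U$ in all possible ways. For a set $I$ of ground regular atoms, $I\models a$ iff $a\in I$ for regular $a$; $I\models t=s$ iff $t,s$ are the same element; $I\models\mathrm{not}\,a$ iff $I\not\models a$. The GeLi-reduct $Q^{\mathrm{x}(U,I)}$ of a ground program $Q$ consists of the rules $\alpha\leftarrow(\beta\setminus\beta^{\mathrm{x}}),\ \bigcup_{\forall\mathbf{Y}.a\Rightarrow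 b\,\in\,\beta^{\mathrm{x}}}\{b[\mathbf{Y}|\mathbf{y}]\mid\mathbf{y}\subseteq U,\ I\models a[\mathbf{Y}|\mathbf{y}]\}$ for $\alpha\leftarrow\beta\in Q$. For a ground program $Q$ without generalized literals (bodies possibly infinite), $Q^I=\{\alpha^+\leftarrow\beta^+\mid\alpha\leftarrow\beta\in Q,\ I\models\mathrm{not}\,\beta^-,\ I\models\alpha^-\}$, and $I$ is an answer set of $Q$ if $I$ is a subset-minimal model of $Q^I$. An open answer set of $P$ is a pair $(U,M)$, $U$ a universe for $P$, $M$ a set of ground regular atoms over the predicates of $P$ and $U$, with $M$ an answer set of $(P_U)^{\mathrm{x}(U,M)}$. **Stratified Datalog.** A Datalog rule is a rule $a\leftarrow\beta$ with head a single regular atom $a$, and $\beta$ a finite set of literals and (if generalized literals are allowed) generalized literals. A basic Datalog program is a finite set of Datalog rules in which no head predicate occurs in a negative body or as the predicate of the antecedent $a$ of a generalized literal $\forall\mathbf{Y}.a\Rightarrow b$. Predicates that occur only in rule bodies (including in generalized literals) are extensional; equality is always extensional; $\mathrm{edb}(P)$ is the set of extensional predicates of $P$. A stratified Datalog program is a union of basic Datalog programs $(P_1,\dots,P_n)$ (strata) such that each head predicate of $P$ is a head predicate in exactly one stratum, and whenever a head predicate in $P_i$ is extensional in $P_j$ then $i<j$. $\mathrm{id}(U)=\{x=x\mid x\in U\}$. For an input structure $\mathcal{U}$ over the extensional predicates of $P$ (a set of ground atoms over $U$, with equality interpreted as $\mathrm{id}(U)$), put $\mathcal{U}_0=\mathcal{U}$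 and $\mathcal{U}_i=\mathcal{U}_{i-1}\cup S_i$, where $S_i$ is the minimal model (over domain $U$) of the first-order clauses $\Sigma_{P_i}$ corresponding to the rules of $P_i$ (universally quantified implications, $\mathrm{not}$ read as $\neg$) among those models whose restriction to $\mathrm{edb}(P_i)$ equals $\mathcal{U}_{i-1}|\mathrm{edb}(P_i)$; here a generalized literal $\forall\mathbf{Y}.a\Rightarrow b$ is, for each grounding of its free variables, instantiated by the conjunction of the $b[\mathbf{Y}|\mathbf{y}]$ for which $a[\mathbf{Y}|\mathbf{y}]$ is true ($a$ being extensional in $P_i$). The least fixed point model of $P$ with input $\mathcal{U}$ is $\mathcal{U}_n$. *)

theory Defs
  imports Main "HOL-Library.Countable_Set"
begin

section \<open>Syntax of generalized programs\<close>

datatype ('c, 'v) trm = Const 'c | Var 'v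

datatype ('p, 'c, 'v) atom =
    Reg 'p "('c, 'v) trm list"
  | Eq "('c, 'v) trm" "('c, 'v) trm"

datatype ('p, 'c, 'v) lit =
    Pos (lit_atom: "('p, 'c, 'v) atom")
  | Naf (lit_atom: "('p, 'c, 'v) atom")

text \<open>\<open>Gen Y a b\<close> is the generalized literal \<open>\<forall>Y. a \<Rightarrow> b\<close>; the variables in \<open>Y\<close> are bound.\<close>

datatype ('p, 'c, 'v) glit =
  Gen (bound: "'v list") (antecedent: "('p, 'c, 'v) atom") (consequent: "('p, 'c, 'v) atom")

text \<open>
  The body \<open>\<beta>\<close> of a rule is stored as two sets: \<open>body\<close> is the set of literals
  \<open>\<beta> - \<beta>\<^sup>x\<close> and \<open>gbody\<close> is the set \<open>\<beta>\<^sup>x\<close> of generalized literals.  Bodies are sets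
  that need not be finite, since reducts may have infinite bodies.
\<close>

datatype ('p, 'c, 'v) rule =
  Rule (head: "('p, 'c, 'v) lit set") (body: "('p, 'c, 'v) lit set") (gbody: "('p, 'c, 'v) glit set")

type_synonym ('p, 'c, 'v) program = "('p, 'c, 'v) rule set"

text \<open>A predicate is equality or a symbol together with its arity (\<open>p/n\<close>).\<close>

datatype 'p pred = EqP | Pred 'p nat

primrec pred_of :: "('p, 'c, 'v) atom \<Rightarrow> 'p pred" where
  "pred_of (Reg p ts) = Pred p (length ts)"
| "pred_of (Eq t s) = EqP"

primrec args :: "('p, 'c, 'v) atom \<Rightarrow> ('c, 'v) trm set" where
  "args (Reg p ts) = set ts"
| "args (Eq t s) = {t, s}"

definition rule_atoms :: "('p, 'c, 'v) rule \<Rightarrow> ('p, 'c, 'v) atom set" where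
  "rule_atoms r = lit_atom ` head r \<union> lit_atom ` body r
     \<union> antecedent ` gbody r \<union> consequent ` gbody r"

definition prog_atoms :: "('p, 'c, 'v) program \<Rightarrow> ('p, 'c, 'v) atom set" where
  "prog_atoms P = (\<Union>r\<in>P. rule_atoms r)"

definition preds :: "('p, 'c, 'v) program \<Rightarrow> 'p pred set" where
  "preds P = pred_of ` prog_atoms P"

definition consts_of :: "('p, 'c, 'v) program \<Rightarrow> 'c set" where
  "consts_of P = {c. \<exists>a\<in>prog_atoms P. Const c \<in> args a}"

section \<open>Grounding\<close>

definition universe :: "'c set \<Rightarrow> ('p, 'c, 'v) program \<Rightarrow> bool" where
  "universe U P \<longleftrightarrow> U \<noteq> {} \<and> countable U \<and> consts_of P \<subseteq> U"

text \<open>The ground atoms over a set of predicates and the elements of \<open>U\<close>.\<close>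

definition atoms_over :: "'p pred set \<Rightarrow> 'c set \<Rightarrow> ('p, 'c, 'v) atom set" where
  "atoms_over Q U = {a. pred_of a \<in> Q \<and> args a \<subseteq> Const ` U}"

primrec subst_trm :: "('v \<Rightarrow> ('c, 'v) trm) \<Rightarrow> ('c, 'v) trm \<Rightarrow> ('c, 'v) trm" where
  "subst_trm \<theta> (Const c) = Const c"
| "subst_trm \<theta> (Var v) = \<theta> v"

primrec subst_atom :: "('v \<Rightarrow> ('c, 'v) trm) \<Rightarrow> ('p, 'c, 'v) atom \<Rightarrow> ('p, 'c, 'v) atom" where
  "subst_atom \<theta> (Reg p ts) = Reg p (map (subst_trm \<theta>) ts)"
| "subst_atom \<theta> (Eq t s) = Eq (subst_trm \<theta> t) (subst_trm \<theta> s)"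

text \<open>\<open>inst X \<sigma>\<close> replaces exactly the variables in \<open>X\<close>, by the elements given by \<open>\<sigma>\<close>.\<close>

definition inst :: "'v set \<Rightarrow> ('v \<Rightarrow> 'c) \<Rightarrow> ('p, 'c, 'v) atom \<Rightarrow> ('p, 'c, 'v) atom" where
  "inst X \<sigma> = subst_atom (\<lambda>v. if v \<in> X then Const (\<sigma> v) else Var v)"

primrec ground_lit :: "('v \<Rightarrow> 'c) \<Rightarrow> ('p, 'c, 'v) lit \<Rightarrow> ('p, 'c, 'v) lit" where
  "ground_lit \<sigma> (Pos a) = Pos (inst UNIV \<sigma> a)"
| "ground_lit \<sigma> (Naf a) = Naf (inst UNIV \<sigma> a)"

primrec ground_glit :: "('v \<Rightarrow> 'c) \<Rightarrow> ('p, 'c, 'v) glit \<Rightarrow> ('p, 'c, 'v) glit" where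
  "ground_glit \<sigma> (Gen Y a b) = Gen Y (inst (- set Y) \<sigma> a) (inst (- set Y) \<sigma> b)"

definition ground_rule :: "('v \<Rightarrow> 'c) \<Rightarrow> ('p, 'c, 'v) rule \<Rightarrow> ('p, 'c, 'v) rule" where
  "ground_rule \<sigma> r =
     Rule (ground_lit \<sigma> ` head r) (ground_lit \<sigma> ` body r) (ground_glit \<sigma> ` gbody r)"

definition ground :: "'c set \<Rightarrow> ('p, 'c, 'v) program \<Rightarrow> ('p, 'c, 'v) program" where
  "ground U P = {ground_rule \<sigma> r | \<sigma> r. r \<in> P \<and> range \<sigma> \<subseteq> U}"

section \<open>Open answer sets\<close>

primrec sat :: "('p, 'c, 'v) atom set \<Rightarrow> ('p, 'c, 'v) atom \<Rightarrow> bool" where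
  "sat I (Reg p ts) \<longleftrightarrow> Reg p ts \<in> I"
| "sat I (Eq t s) \<longleftrightarrow> t = s"

primrec sat_lit :: "('p, 'c, 'v) atom set \<Rightarrow> ('p, 'c, 'v) lit \<Rightarrow> bool" where
  "sat_lit I (Pos a) \<longleftrightarrow> sat I a"
| "sat_lit I (Naf a) \<longleftrightarrow> \<not> sat I a"

text \<open>
  The atoms \<open>b[Y|y]\<close>, with \<open>y\<close> from \<open>U\<close>, for which \<open>a[Y|y]\<close> is true; \<open>T\<close> is the truth
  predicate on ground atoms.
\<close>

definition glit_insts ::
    "'c set \<Rightarrow> (('p, 'c, 'v) atom \<Rightarrow> bool) \<Rightarrow> ('p, 'c, 'v) glit \<Rightarrow> ('p, 'c, 'v) atom set" where
  "glit_insts U T g = {inst (set (bound g)) y (consequent g) | y.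
     y ` set (bound g) \<subseteq> U \<and> T (inst (set (bound g)) y (antecedent g))}"

definition geli_reduct ::
    "'c set \<Rightarrow> ('p, 'c, 'v) atom set \<Rightarrow> ('p, 'c, 'v) program \<Rightarrow> ('p, 'c, 'v) program" where
  "geli_reduct U I Q =
     {Rule (head r) (body r \<union> Pos ` (\<Union>g\<in>gbody r. glit_insts U (sat I) g)) {} | r. r \<in> Q}"

text \<open>The rules of a Gelfond-Lifschitz reduct are represented as pairs \<open>(\<alpha>\<^sup>+, \<beta>\<^sup>+)\<close>.\<close>

definition gl_reduct ::
    "('p, 'c, 'v) atom set \<Rightarrow> ('p, 'c, 'v) program
     \<Rightarrow> (('p, 'c, 'v) atom set \<times> ('p, 'c, 'v) atom set) set" where
  "gl_reduct I Q = {({a. Pos a \<in> head r}, {a. Pos a \<in> body r}) | r. r \<in> Q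
     \<and> (\<forall>a. Naf a \<in> body r \<longrightarrow> \<not> sat I a) \<and> (\<forall>a. Naf a \<in> head r \<longrightarrow> sat I a)}"

definition is_model ::
    "('p, 'c, 'v) atom set \<Rightarrow> (('p, 'c, 'v) atom set \<times> ('p, 'c, 'v) atom set) set \<Rightarrow> bool" where
  "is_model I R \<longleftrightarrow> (\<forall>(\<alpha>, \<beta>)\<in>R. (\<forall>a\<in>\<beta>. sat I a) \<longrightarrow> (\<exists>a\<in>\<alpha>. sat I a))"

definition answer_set :: "('p, 'c, 'v) atom set \<Rightarrow> ('p, 'c, 'v) program \<Rightarrow> bool" where
  "answer_set I Q \<longleftrightarrow>
     is_model I (gl_reduct I Q) \<and> (\<forall>J. J \<subset> I \<longrightarrow> \<not> is_model J (gl_reduct I Q))"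

definition open_answer_set ::
    "('p, 'c, 'v) program \<Rightarrow> 'c set \<Rightarrow> ('p, 'c, 'v) atom set \<Rightarrow> bool" where
  "open_answer_set P U M \<longleftrightarrow>
     universe U P \<and> M \<subseteq> atoms_over (preds P - {EqP}) U \<and>
     answer_set M (geli_reduct U M (ground U P))"

section \<open>Stratified Datalog\<close>

definition datalog_rule :: "('p, 'c, 'v) rule \<Rightarrow> bool" where
  "datalog_rule r \<longleftrightarrow> (\<exists>p ts. head r = {Pos (Reg p ts)}) \<and> finite (body r) \<and> finite (gbody r)"

definition head_preds :: "('p, 'c, 'v) program \<Rightarrow> 'p pred set" where
  "head_preds P = (\<Union>r\<in>P. pred_of ` lit_atom ` head r)"

definition neg_body_preds :: "('p, 'c, 'v) program \<Rightarrow> 'p pred set" where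
  "neg_body_preds P = (\<Union>r\<in>P. pred_of ` {a. Naf a \<in> body r})"

definition antecedent_preds :: "('p, 'c, 'v) program \<Rightarrow> 'p pred set" where
  "antecedent_preds P = (\<Union>r\<in>P. pred_of ` antecedent ` gbody r)"

definition edb :: "('p, 'c, 'v) program \<Rightarrow> 'p pred set" where
  "edb P = insert EqP (preds P - head_preds P)"

definition basic_datalog :: "('p, 'c, 'v) program \<Rightarrow> bool" where
  "basic_datalog P \<longleftrightarrow> finite P \<and> (\<forall>r\<in>P. datalog_rule r) \<and>
     head_preds P \<inter> (neg_body_preds P \<union> antecedent_preds P) = {}"

text \<open>
  Strata are given as a list \<open>[P\<^sub>1, \<dots>, P\<^sub>n]\<close>, indexed from \<open>0\<close>; the program itself is their union.
\<close>

definition stratified :: "('p, 'c, 'v) program list \<Rightarrow> bool" where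
  "stratified Ps \<longleftrightarrow>
     (\<forall>P\<in>set Ps. basic_datalog P) \<and>
     (\<forall>q\<in>head_preds (\<Union>(set Ps)). \<exists>!i. i < length Ps \<and> q \<in> head_preds (Ps ! i)) \<and>
     (\<forall>i<length Ps. \<forall>j<length Ps. \<forall>q\<in>head_preds (Ps ! i). q \<in> edb (Ps ! j) \<longrightarrow> i < j)"

section \<open>Least fixed point models\<close>

text \<open>
  A structure with domain \<open>U\<close> is identified with its set of true ground atoms.  In contrast to
  interpretations in the sense of \<open>sat\<close>, this includes the equality atoms, so equality is
  interpreted by membership as well.
\<close>

primrec holds :: "('p, 'c, 'v) atom set \<Rightarrow> ('p, 'c, 'v) lit \<Rightarrow> bool" where
  "holds S (Pos a) \<longleftrightarrow> a \<in> S"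
| "holds S (Naf a) \<longleftrightarrow> a \<notin> S"

definition id_atoms :: "'c set \<Rightarrow> ('p, 'c, 'v) atom set" where
  "id_atoms U = {Eq (Const x) (Const x) | x. x \<in> U}"

definition restrict_struct ::
    "('p, 'c, 'v) atom set \<Rightarrow> 'p pred set \<Rightarrow> ('p, 'c, 'v) atom set" where
  "restrict_struct S Q = {a \<in> S. pred_of a \<in> Q}"

text \<open>\<open>S\<close> is a model, with domain \<open>U\<close>, of the first-order clauses \<open>\<Sigma>\<^sub>P\<close>.\<close>

definition clause_model :: "'c set \<Rightarrow> ('p, 'c, 'v) program \<Rightarrow> ('p, 'c, 'v) atom set \<Rightarrow> bool" where
  "clause_model U P S \<longleftrightarrow> S \<subseteq> atoms_over (insert EqP (preds P)) U \<and>
     (\<forall>r\<in>ground U P.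
        (\<forall>l\<in>body r. holds S l) \<and> (\<forall>g\<in>gbody r. \<forall>b\<in>glit_insts U (\<lambda>a. a \<in> S) g. b \<in> S)
        \<longrightarrow> (\<exists>l\<in>head r. holds S l))"

definition edb_models ::
    "'c set \<Rightarrow> ('p, 'c, 'v) program \<Rightarrow> ('p, 'c, 'v) atom set \<Rightarrow> ('p, 'c, 'v) atom set set" where
  "edb_models U P X =
     {S. clause_model U P S \<and> restrict_struct S (edb P) = restrict_struct X (edb P)}"

text \<open>
  For a basic Datalog program \<open>P\<close> and a structure \<open>X\<close> over \<open>U\<close>, there is exactly one minimal
  element of \<open>edb_models U P X\<close>.
\<close>

definition minimal_model ::
    "'c set \<Rightarrow> ('p, 'c, 'v) program \<Rightarrow> ('p, 'c, 'v) atom set \<Rightarrow> ('p, 'c, 'v) atom set" where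
  "minimal_model U P X =
     (THE S. S \<in> edb_models U P X \<and> (\<forall>S'\<in>edb_models U P X. \<not> S' \<subset> S))"

primrec stage ::
    "'c set \<Rightarrow> ('p, 'c, 'v) program list \<Rightarrow> ('p, 'c, 'v) atom set \<Rightarrow> nat
     \<Rightarrow> ('p, 'c, 'v) atom set" where
  "stage U Ps X 0 = X"
| "stage U Ps X (Suc i) = stage U Ps X i \<union> minimal_model U (Ps ! i) (stage U Ps X i)"

definition lfp_model ::
    "'c set \<Rightarrow> ('p, 'c, 'v) program list \<Rightarrow> ('p, 'c, 'v) atom set \<Rightarrow> ('p, 'c, 'v) atom set" where
  "lfp_model U Ps X = stage U Ps X (length Ps)"

end

theory Submission imports Defs
begin

text \<open>
  For a Datalog program both semantics compare interpretations with the sets closed under rules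
  whose negative body and antecedents are evaluated in a fixed interpretation.  Stratification lets
  one split such a set along the strata: on the predicates of a stratum, an open answer set extended
  by the equality atoms is the least clause model agreeing with itself on the extensional
  predicates.  Removing from an open answer set all head atoms of a stratum that are false in a
  competing clause model leaves a closed set, which by minimality is the whole answer set;
  induction on the strata then identifies it with the stages.  Conversely, a closed subset of the
  last stage yields, stratum by stratum, a competing clause model and hence contains every stage.
\<close>

section \<open>Closed sets\<close>

text \<open>Two interpretations separate the roles fixed by the reducts: \<open>M\<close> decides
  naf-literals and antecedents, \<open>J\<close> decides positive literals and consequents. With
  \<open>J = M\<close> this is ordinary truth of the body.\<close>

definition fires ::
    "'c set \<Rightarrow> ('p, 'c, 'v) atom set \<Rightarrow> ('p, 'c, 'v) atom set \<Rightarrow> ('p, 'c, 'v) rule \<Rightarrow> bool" where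
  "fires U M J r \<longleftrightarrow> (\<forall>a. Pos a \<in> body r \<longrightarrow> sat J a) \<and> (\<forall>a. Naf a \<in> body r \<longrightarrow> \<not> sat M a) \<and>
     (\<forall>g\<in>gbody r. \<forall>b\<in>glit_insts U (sat M) g. sat J b)"

text \<open>Closure relative to a fixed \<open>M\<close> stands for being a model of the double
  reduct by \<open>M\<close>. Membership of the head suffices for Datalog rules, whose heads are
  single regular atoms.\<close>

definition closed_under ::
    "'c set \<Rightarrow> ('p, 'c, 'v) program \<Rightarrow> ('p, 'c, 'v) atom set \<Rightarrow> ('p, 'c, 'v) atom set \<Rightarrow> bool" where
  "closed_under U P M J \<longleftrightarrow>
     (\<forall>r\<in>ground U P. fires U M J r \<longrightarrow> (\<forall>a. Pos a \<in> head r \<longrightarrow> a \<in> J))"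

lemma sat_cong:
  assumes "\<And>p ts. a = Reg p ts \<Longrightarrow> a \<in> I \<longleftrightarrow> a \<in> J"
  shows "sat I a \<longleftrightarrow> sat J a"
  using assms by (cases a) auto

lemma sat_mono: "sat I a \<Longrightarrow> I \<subseteq> J \<Longrightarrow> sat J a"
  by (cases a) auto

text \<open>\<open>sat\<close> decides equality atoms by identity of terms, so removing or adding
  members of id(U) changes no truth value. This links answer sets, which consist of regular atoms,
  with structures, which contain id(U).\<close>

lemma sat_diff_id_atoms [simp]: "sat (S - id_atoms U) = sat S"
  by (rule ext, rule sat_cong) (auto simp: id_atoms_def)

lemma sat_Un_id_atoms [simp]: "sat (S \<union> id_atoms U) = sat S"
  by (rule ext, rule sat_cong) (auto simp: id_atoms_def)

lemma fires_sat_cong: "sat M = sat M' \<Longrightarrow> sat J = sat J' \<Longrightarrow> fires U M J r \<longleftrightarrow> fires U M' J' r"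
  by (simp add: fires_def)

section \<open>Atoms and predicates of a grounded program\<close>

lemma pred_of_inst [simp]: "pred_of (inst X \<sigma> a) = pred_of a"
  by (cases a) (auto simp: inst_def)

lemma args_inst: "args (inst X \<sigma> a) = subst_trm (\<lambda>v. if v \<in> X then Const (\<sigma> v) else Var v) ` args a"
  by (cases a) (auto simp: inst_def)

lemma args_inst_UNIV:
  assumes "\<And>c. Const c \<in> args a \<Longrightarrow> c \<in> U" "range \<sigma> \<subseteq> U"
  shows "args (inst UNIV \<sigma> a) \<subseteq> Const ` U"
proof
  fix t assume "t \<in> args (inst UNIV \<sigma> a)"
  then obtain s where "s \<in> args a" "t = subst_trm (\<lambda>v. Const (\<sigma> v)) s"
    by (auto simp: args_inst)
  then show "t \<in> Const ` U" using assms by (cases s) (auto simp: image_subset_iff)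
qed

text \<open>Atoms of a generalized literal are instantiated twice: the free variables by grounding,
  the bound ones by the reduct. Together the two substitutions replace every variable by an element
  of \<open>U\<close>.\<close>

lemma args_inst_bound:
  assumes "\<And>c. Const c \<in> args a \<Longrightarrow> c \<in> U" "range \<sigma> \<subseteq> U" "y ` X \<subseteq> U"
  shows "args (inst X y (inst (- X) \<sigma> a)) \<subseteq> Const ` U"
proof
  fix t assume "t \<in> args (inst X y (inst (- X) \<sigma> a))"
  then obtain s where "s \<in> args a"
    "t = subst_trm (\<lambda>v. if v \<in> X then Const (y v) else Var v)
           (subst_trm (\<lambda>v. if v \<in> - X then Const (\<sigma> v) else Var v) s)"
    by (auto simp: args_inst)
  then show "t \<in> Const ` U" using assms by (cases s) (auto simp: image_subset_iff)
qed

lemma ground_Union: "r \<in> ground U (\<Union>(set Ps)) \<longleftrightarrow> (\<exists>i<length Ps. r \<in> ground U (Ps ! i))"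
  by (fastforce simp: ground_def in_set_conv_nth)

lemma const_in_universe:
  "consts_of P \<subseteq> U \<Longrightarrow> a \<in> prog_atoms P \<Longrightarrow> Const c \<in> args a \<Longrightarrow> c \<in> U"
  by (auto simp: consts_of_def)

lemma atom_in_prog:
  assumes "r \<in> P"
  shows "l \<in> head r \<Longrightarrow> lit_atom l \<in> prog_atoms P"
    and "l \<in> body r \<Longrightarrow> lit_atom l \<in> prog_atoms P"
    and "g \<in> gbody r \<Longrightarrow> antecedent g \<in> prog_atoms P"
    and "g \<in> gbody r \<Longrightarrow> consequent g \<in> prog_atoms P"
  using assms by (auto simp: prog_atoms_def rule_atoms_def)

lemma Naf_eq_ground_lit:
  "Naf a = ground_lit \<sigma> l \<longleftrightarrow> (\<exists>b. l = Naf b \<and> a = inst UNIV \<sigma> b)"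
  by (cases l) auto

lemma atom_in_ground_body:
  assumes "r \<in> ground U P" "consts_of P \<subseteq> U" "l \<in> body r"
  shows "lit_atom l \<in> atoms_over (preds P) U"
proof -
  obtain \<sigma> r0 where r: "r = ground_rule \<sigma> r0" "r0 \<in> P" "range \<sigma> \<subseteq> U"
    using assms(1) by (auto simp: ground_def)
  obtain l0 where l0: "l0 \<in> body r0" "l = ground_lit \<sigma> l0"
    using assms(3) by (auto simp: r ground_rule_def)
  have "lit_atom l = inst UNIV \<sigma> (lit_atom l0)"
    using l0 by (cases l0) auto
  moreover have "lit_atom l0 \<in> prog_atoms P" using atom_in_prog r l0 by blast
  moreover have "args (inst UNIV \<sigma> (lit_atom l0)) \<subseteq> Const ` U"
    by (rule args_inst_UNIV[OF const_in_universe[OF assms(2) calculation(2)] r(3)])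
  ultimately show ?thesis by (auto simp: atoms_over_def preds_def)
qed

lemma glit_in_ground:
  assumes "r \<in> ground U P" "consts_of P \<subseteq> U" "g \<in> gbody r" "y ` set (bound g) \<subseteq> U"
  shows "inst (set (bound g)) y (antecedent g) \<in> atoms_over (antecedent_preds P \<inter> preds P) U"
    and "inst (set (bound g)) y (consequent g) \<in> atoms_over (preds P) U"
proof -
  obtain \<sigma> r0 where r: "r = ground_rule \<sigma> r0" "r0 \<in> P" "range \<sigma> \<subseteq> U"
    using assms(1) by (auto simp: ground_def)
  obtain g' where g': "g' \<in> gbody r0" "g = ground_glit \<sigma> g'"
    using assms(3) by (auto simp: r ground_rule_def)
  obtain Y a b where "g' = Gen Y a b" by (cases g')
  with g' have g0: "Gen Y a b \<in> gbody r0" and g: "g = ground_glit \<sigma> (Gen Y a b)" by simp_all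
  have ab: "a \<in> prog_atoms P" "b \<in> prog_atoms P"
    using atom_in_prog(3,4)[OF r(2) g0] by auto
  have "pred_of a \<in> antecedent_preds P"
    using g0 r(2) by (force simp: antecedent_preds_def)
  moreover have "args (inst (set Y) y (inst (- set Y) \<sigma> a)) \<subseteq> Const ` U"
    "args (inst (set Y) y (inst (- set Y) \<sigma> b)) \<subseteq> Const ` U"
    using assms(4) by (intro args_inst_bound[OF const_in_universe[OF assms(2)] r(3)]; simp add: g ab)+
  ultimately show "inst (set (bound g)) y (antecedent g) \<in> atoms_over (antecedent_preds P \<inter> preds P) U"
    and "inst (set (bound g)) y (consequent g) \<in> atoms_over (preds P) U"
    using ab by (auto simp: g atoms_over_def preds_def)
qed

lemma ground_head:
  assumes "r \<in> ground U P" "consts_of P \<subseteq> U" "\<forall>r\<in>P. datalog_rule r"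
  obtains p ts where "head r = {Pos (Reg p ts)}" "Reg p ts \<in> atoms_over (head_preds P) U"
proof -
  obtain \<sigma> r0 where r: "r = ground_rule \<sigma> r0" "r0 \<in> P" "range \<sigma> \<subseteq> U"
    using assms(1) by (auto simp: ground_def)
  obtain p ts where h: "head r0 = {Pos (Reg p ts)}"
    using assms(3) r(2) by (auto simp: datalog_rule_def)
  have "Reg p ts \<in> prog_atoms P" using atom_in_prog(1)[OF r(2), of "Pos (Reg p ts)"] h by simp
  then have "args (inst UNIV \<sigma> (Reg p ts)) \<subseteq> Const ` U"
    by (rule args_inst_UNIV[OF const_in_universe[OF assms(2)] r(3)])
  moreover have "Pred p (length ts) \<in> head_preds P"
    unfolding head_preds_def using r(2) by (rule UN_I) (simp add: h)
  moreover have "head r = {Pos (inst UNIV \<sigma> (Reg p ts))}"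
    using h by (simp add: r(1) ground_rule_def)
  ultimately show ?thesis
    by (rule_tac that[of p "map (subst_trm (\<lambda>v. Const (\<sigma> v))) ts"])
      (simp_all add: inst_def atoms_over_def)
qed

lemma EqP_not_head:
  assumes "\<forall>r\<in>P. datalog_rule r"
  shows "EqP \<notin> head_preds P"
proof
  assume "EqP \<in> head_preds P"
  then obtain r l where "r \<in> P" "l \<in> head r" "EqP = pred_of (lit_atom l)"
    by (auto simp: head_preds_def)
  moreover from this(1) obtain p ts where "head r = {Pos (Reg p ts)}"
    using assms by (auto simp: datalog_rule_def)
  ultimately show False by simp
qed

lemma head_preds_subset: "head_preds P \<subseteq> preds P"
  by (auto simp: head_preds_def preds_def prog_atoms_def rule_atoms_def)

lemma edb_Un_head: "edb P \<union> head_preds P = insert EqP (preds P)"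
  using head_preds_subset[of P] by (auto simp: edb_def)

text \<open>Basic programs keep head predicates out of negative bodies, so naf-literals depend on
  the extensional part alone. The same holds for antecedents in
  \<open>antecedent_in_ground\<close>.\<close>

lemma naf_in_ground:
  assumes "basic_datalog P" "r \<in> ground U P" "Naf a \<in> body r"
  shows "pred_of a \<in> edb P"
proof -
  obtain \<sigma> r0 where r: "r = ground_rule \<sigma> r0" "r0 \<in> P"
    using assms(2) by (auto simp: ground_def)
  obtain b where b: "Naf b \<in> body r0" "a = inst UNIV \<sigma> b"
    using assms(3) by (auto simp: r ground_rule_def Naf_eq_ground_lit)
  have "pred_of b \<in> neg_body_preds P" using b r by (auto simp: neg_body_preds_def)
  moreover have "pred_of b \<in> preds P"
    using atom_in_prog(2)[OF r(2) b(1)] by (auto simp: preds_def)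
  ultimately show ?thesis using assms(1) b by (auto simp: basic_datalog_def edb_def)
qed

lemma antecedent_in_ground:
  assumes "basic_datalog P" "consts_of P \<subseteq> U" "r \<in> ground U P" "g \<in> gbody r"
    "y ` set (bound g) \<subseteq> U"
  shows "pred_of (inst (set (bound g)) y (antecedent g)) \<in> edb P"
  using glit_in_ground(1)[OF assms(3,2,4,5)] assms(1)
  by (auto simp: basic_datalog_def edb_def atoms_over_def)

section \<open>Comparing rule bodies in two interpretations\<close>

lemma glit_insts_cong:
  assumes "\<And>y. y ` set (bound g) \<subseteq> U \<Longrightarrow>
      T (inst (set (bound g)) y (antecedent g)) = T' (inst (set (bound g)) y (antecedent g))"
  shows "glit_insts U T g = glit_insts U T' g"
  using assms by (auto simp: glit_insts_def)

text \<open>Positive literals and consequents are monotone in \<open>J\<close>, while naf-literals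
  and antecedents are extensional. Hence an implication on the predicates of \<open>P\<close> and
  agreement on \<open>edb P\<close> are enough to carry a firing rule over.\<close>

lemma fires_transfer:
  assumes P: "basic_datalog P" "consts_of P \<subseteq> U" "r \<in> ground U P"
    and "fires U M J r"
    and J: "\<And>a. pred_of a \<in> preds P \<Longrightarrow> sat J a \<Longrightarrow> sat J' a"
    and M: "\<And>a. pred_of a \<in> edb P \<Longrightarrow> sat M a \<longleftrightarrow> sat M' a"
  shows "fires U M' J' r"
proof -
  have "sat J' a" if "Pos a \<in> body r" for a
    using that atom_in_ground_body[OF P(3,2) that] assms(4) J by (auto simp: fires_def atoms_over_def)
  moreover have "\<not> sat M' a" if "Naf a \<in> body r" for a
    using that naf_in_ground[OF P(1,3) that] assms(4) M by (auto simp: fires_def)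
  moreover have "sat J' b" if "g \<in> gbody r" "b \<in> glit_insts U (sat M') g" for g b
  proof -
    \<comment> \<open>Antecedents are extensional, so both interpretations select the same
      consequents.\<close>
    have "glit_insts U (sat M') g = glit_insts U (sat M) g"
      by (rule glit_insts_cong) (use antecedent_in_ground[OF P that(1)] M in blast)
    moreover have "pred_of b \<in> preds P"
      using that glit_in_ground(2)[OF P(3,2) that(1)] by (auto simp: glit_insts_def atoms_over_def)
    ultimately show ?thesis using that assms(4) J by (auto simp: fires_def)
  qed
  ultimately show ?thesis by (auto simp: fires_def)
qed

text \<open>A grounded Datalog head is one positive regular atom, so its truth is membership. The
  consequents that the GeLi-reduct adds to a body become the third conjunct of \<open>fires\<close>,
  the naf-literals that the second reduct evaluates become its second.\<close>

lemma is_model_reduct_iff: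
  fixes P :: "('p, 'c, 'v) program"
  assumes "consts_of P \<subseteq> U" "\<forall>r\<in>P. datalog_rule r"
  shows "is_model J (gl_reduct M (geli_reduct U M (ground U P))) \<longleftrightarrow> closed_under U P M J"
proof -
  \<comment> \<open>\<open>R\<close> reduces a single rule. The reduct is then the image of the
    grounding under \<open>R\<close>, and quantifiers over it pull back to ground rules.\<close>
  define R where "R = (\<lambda>r :: ('p, 'c, 'v) rule.
    Rule (head r) (body r \<union> Pos ` (\<Union>g\<in>gbody r. glit_insts U (sat M) g)) {})"
  have gl: "is_model J (gl_reduct M Q) \<longleftrightarrow>
    (\<forall>r\<in>Q. (\<forall>a. Naf a \<in> body r \<longrightarrow> \<not> sat M a) \<and> (\<forall>a. Naf a \<in> head r \<longrightarrow> sat M a) \<and>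
       (\<forall>a. Pos a \<in> body r \<longrightarrow> sat J a) \<longrightarrow> (\<exists>a. Pos a \<in> head r \<and> sat J a))"
    for Q :: "('p, 'c, 'v) program"
    unfolding is_model_def gl_reduct_def setcompr_eq_image by auto
  have "geli_reduct U M (ground U P) = R ` ground U P"
    by (auto simp: geli_reduct_def R_def)
  then have "is_model J (gl_reduct M (geli_reduct U M (ground U P))) \<longleftrightarrow>
    (\<forall>r\<in>ground U P. (\<forall>a. Naf a \<in> body (R r) \<longrightarrow> \<not> sat M a) \<and> (\<forall>a. Naf a \<in> head (R r) \<longrightarrow> sat M a) \<and>
       (\<forall>a. Pos a \<in> body (R r) \<longrightarrow> sat J a) \<longrightarrow> (\<exists>a. Pos a \<in> head (R r) \<and> sat J a))"
    by (simp only: gl ball_simps)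
  also have "\<dots> \<longleftrightarrow> closed_under U P M J"
    unfolding closed_under_def
  proof (rule ball_cong[OF refl])
    fix r assume r: "r \<in> ground U P"
    have R: "head (R r) = head r" "\<And>a. Naf a \<in> body (R r) \<longleftrightarrow> Naf a \<in> body r"
      "\<And>a. Pos a \<in> body (R r) \<longleftrightarrow> Pos a \<in> body r \<or> (\<exists>g\<in>gbody r. a \<in> glit_insts U (sat M) g)"
      by (auto simp: R_def)
    obtain p ts where "head r = {Pos (Reg p ts)}" using ground_head[OF r assms] .
    then show "((\<forall>a. Naf a \<in> body (R r) \<longrightarrow> \<not> sat M a) \<and> (\<forall>a. Naf a \<in> head (R r) \<longrightarrow> sat M a) \<and>
       (\<forall>a. Pos a \<in> body (R r) \<longrightarrow> sat J a) \<longrightarrow> (\<exists>a. Pos a \<in> head (R r) \<and> sat J a)) \<longleftrightarrow>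
       (fires U M J r \<longrightarrow> (\<forall>a. Pos a \<in> head r \<longrightarrow> a \<in> J))"
      unfolding R by (auto simp: fires_def)
  qed
  finally show ?thesis .
qed

section \<open>Minimal models of a stratum\<close>

text \<open>The first hypothesis says that \<open>S\<close> interprets equality as the identity on
  \<open>U\<close>. This reconciles truth by membership in structures with
  \<open>sat\<close>.\<close>

lemma mem_iff_sat:
  assumes "restrict_struct S {EqP} = id_atoms U" "args a \<subseteq> Const ` U"
  shows "a \<in> S \<longleftrightarrow> sat S a"
proof (cases a)
  case (Eq t s)
  have "a \<in> S \<longleftrightarrow> a \<in> restrict_struct S {EqP}" by (simp add: restrict_struct_def Eq)
  then show ?thesis using assms Eq by (auto simp: id_atoms_def)
qed simp

lemma clause_model_iff:
  assumes P: "basic_datalog P" "consts_of P \<subseteq> U" and S: "restrict_struct S {EqP} = id_atoms U"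
  shows "clause_model U P S \<longleftrightarrow>
    S \<subseteq> atoms_over (insert EqP (preds P)) U \<and> closed_under U P S S"
proof -
  have "((\<forall>l\<in>body r. holds S l) \<and> (\<forall>g\<in>gbody r. \<forall>b\<in>glit_insts U (\<lambda>a. a \<in> S) g. b \<in> S)
        \<longrightarrow> (\<exists>l\<in>head r. holds S l)) \<longleftrightarrow> (fires U S S r \<longrightarrow> (\<forall>a. Pos a \<in> head r \<longrightarrow> a \<in> S))"
    if r: "r \<in> ground U P" for r
  proof -
    have d: "\<forall>r\<in>P. datalog_rule r" using P by (simp add: basic_datalog_def)
    have "holds S l \<longleftrightarrow> sat_lit S l" if "l \<in> body r" for l
      using atom_in_ground_body[OF r P(2) that] mem_iff_sat[OF S, of "lit_atom l"]
      by (cases l) (auto simp: atoms_over_def)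
    then have "(\<forall>l\<in>body r. holds S l) \<longleftrightarrow> (\<forall>l\<in>body r. sat_lit S l)" by blast
    also have "\<dots> \<longleftrightarrow> (\<forall>a. Pos a \<in> body r \<longrightarrow> sat S a) \<and> (\<forall>a. Naf a \<in> body r \<longrightarrow> \<not> sat S a)"
      by (metis lit.exhaust sat_lit.simps)
    finally have 1: "(\<forall>l\<in>body r. holds S l) \<longleftrightarrow> \<dots>" .
    have "(\<forall>b\<in>glit_insts U (\<lambda>a. a \<in> S) g. b \<in> S) \<longleftrightarrow> (\<forall>b\<in>glit_insts U (sat S) g. sat S b)"
      if g: "g \<in> gbody r" for g
    proof -
      have "glit_insts U (\<lambda>a. a \<in> S) g = glit_insts U (sat S) g"
      proof (rule glit_insts_cong)
        fix y assume "y ` set (bound g) \<subseteq> U"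
        then show "inst (set (bound g)) y (antecedent g) \<in> S \<longleftrightarrow>
            sat S (inst (set (bound g)) y (antecedent g))"
          using glit_in_ground(1)[OF r P(2) g] by (intro mem_iff_sat[OF S]) (auto simp: atoms_over_def)
      qed
      moreover have "b \<in> S \<longleftrightarrow> sat S b" if "b \<in> glit_insts U (sat S) g" for b
        using that glit_in_ground(2)[OF r P(2) g]
        by (intro mem_iff_sat[OF S]) (auto simp: atoms_over_def glit_insts_def)
      ultimately show ?thesis by auto
    qed
    moreover obtain p ts where "head r = {Pos (Reg p ts)}" using ground_head[OF r P(2) d] .
    ultimately show ?thesis using 1 by (simp add: fires_def)
  qed
  then show ?thesis by (simp add: clause_model_def closed_under_def)
qed

section \<open>Least models with a prescribed extensional part\<close>

lemma restrict_structD: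
  assumes "restrict_struct S Q = restrict_struct T Q" "pred_of a \<in> Q"
  shows "a \<in> S \<longleftrightarrow> a \<in> T"
proof -
  have "a \<in> restrict_struct S Q \<longleftrightarrow> a \<in> restrict_struct T Q" by (simp only: assms(1))
  then show ?thesis using assms(2) by (simp add: restrict_struct_def)
qed

lemma restrict_struct_subset_cong:
  assumes "restrict_struct S Q = restrict_struct T Q" "Q' \<subseteq> Q"
  shows "restrict_struct S Q' = restrict_struct T Q'"
  using restrict_structD[OF assms(1)] assms(2) unfolding restrict_struct_def by blast

lemma edb_models_iff:
  assumes P: "basic_datalog P" "consts_of P \<subseteq> U" and X: "restrict_struct X {EqP} = id_atoms U"
  shows "S \<in> edb_models U P X \<longleftrightarrow> S \<subseteq> atoms_over (insert EqP (preds P)) U \<and>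
    restrict_struct S (edb P) = restrict_struct X (edb P) \<and> closed_under U P S S"
proof -
  have "restrict_struct S {EqP} = id_atoms U"
    if "restrict_struct S (edb P) = restrict_struct X (edb P)"
    using restrict_struct_subset_cong[OF that, of "{EqP}"] X by (simp add: edb_def)
  then show ?thesis unfolding edb_models_def mem_Collect_eq using clause_model_iff[OF P, of S] by blast
qed

text \<open>A least element is minimal, and any minimal element contains it and hence equals it, so
  the definite description is determined.\<close>

lemma minimal_model_eqI:
  assumes "S \<in> edb_models U P X" "\<And>S'. S' \<in> edb_models U P X \<Longrightarrow> S \<subseteq> S'"
  shows "minimal_model U P X = S"
  unfolding minimal_model_def using assms by (intro the_equality) blast+

text \<open>All members agree with \<open>X\<close> on \<open>edb P\<close>, so naf-literals and
  antecedents have the same value in the intersection as in each member. A rule firing in the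
  intersection therefore fires in every member.\<close>

lemma edb_models_Inter:
  assumes P: "basic_datalog P" "consts_of P \<subseteq> U" and X: "restrict_struct X {EqP} = id_atoms U"
    and ne: "edb_models U P X \<noteq> {}"
  shows "\<Inter>(edb_models U P X) \<in> edb_models U P X"
proof -
  let ?E = "edb_models U P X"
  let ?I = "\<Inter>?E"
  note iff = edb_models_iff[OF P X]
  obtain S0 where S0: "S0 \<in> ?E" using ne by blast
  have agree: "a \<in> S \<longleftrightarrow> a \<in> X" if "S \<in> ?E" "pred_of a \<in> edb P" for S a
    using that(1) restrict_structD[OF _ that(2), of S X] iff[of S] by blast
  then have agreeI: "a \<in> ?I \<longleftrightarrow> a \<in> X" if "pred_of a \<in> edb P" for a
    using that S0 by blast
  have "closed_under U P ?I ?I"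
    unfolding closed_under_def
  proof (intro ballI impI allI InterI)
    fix r a S
    assume r: "r \<in> ground U P" and f: "fires U ?I ?I r" and a: "Pos a \<in> head r" and S: "S \<in> ?E"
    have "fires U S S r"
    proof (rule fires_transfer[OF P r f])
      show "sat S a" if "sat ?I a" for a using that S by (rule_tac sat_mono) auto
      show "sat ?I a \<longleftrightarrow> sat S a" if "pred_of a \<in> edb P" for a
        using agree[OF S that] agreeI[OF that] by (intro sat_cong) blast
    qed
    then show "a \<in> S" using S iff[of S] r a unfolding closed_under_def by blast
  qed
  moreover have "restrict_struct ?I (edb P) = restrict_struct X (edb P)"
    unfolding restrict_struct_def using agreeI by blast
  moreover have "?I \<subseteq> atoms_over (insert EqP (preds P)) U"
    using S0 iff[of S0] by blast
  ultimately show ?thesis by (intro iff[THEN iffD2] conjI)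
qed

lemma edb_models_nonempty:
  assumes P: "basic_datalog P" "consts_of P \<subseteq> U" and X: "restrict_struct X {EqP} = id_atoms U"
    and "X \<subseteq> atoms_over UNIV U"
  shows "edb_models U P X \<noteq> {}"
proof -
  \<comment> \<open>Making every head atom over \<open>U\<close> true satisfies all rules and leaves
    the extensional part of \<open>X\<close> as it is.\<close>
  let ?T = "restrict_struct X (edb P) \<union> atoms_over (head_preds P) U"
  have d: "\<forall>r\<in>P. datalog_rule r" using P by (simp add: basic_datalog_def)
  have disj: "edb P \<inter> head_preds P = {}" using EqP_not_head[OF d] by (auto simp: edb_def)
  have "closed_under U P ?T ?T"
    unfolding closed_under_def
  proof (intro ballI impI allI)
    fix r a assume r: "r \<in> ground U P" and a: "Pos a \<in> head r"
    obtain p ts where "head r = {Pos (Reg p ts)}" "Reg p ts \<in> atoms_over (head_preds P) U"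
      using ground_head[OF r P(2) d] .
    then show "a \<in> ?T" using a by simp
  qed
  moreover have "restrict_struct ?T (edb P) = restrict_struct X (edb P)"
    using disj by (auto simp: restrict_struct_def atoms_over_def)
  moreover have "?T \<subseteq> atoms_over (insert EqP (preds P)) U"
    using assms(4) edb_Un_head[of P] by (auto simp: restrict_struct_def atoms_over_def)
  ultimately have "?T \<in> edb_models U P X" by (simp add: edb_models_iff[OF P X])
  then show ?thesis by blast
qed

lemma minimal_model_least:
  assumes "basic_datalog P" "consts_of P \<subseteq> U" "restrict_struct X {EqP} = id_atoms U"
    and "X \<subseteq> atoms_over UNIV U"
  shows "minimal_model U P X \<in> edb_models U P X"
    and "S \<in> edb_models U P X \<Longrightarrow> minimal_model U P X \<subseteq> S"
proof -
  have I: "\<Inter>(edb_models U P X) \<in> edb_models U P X"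
    by (rule edb_models_Inter[OF assms(1-3) edb_models_nonempty[OF assms]])
  then have "minimal_model U P X = \<Inter>(edb_models U P X)"
    by (rule minimal_model_eqI) blast
  then show "minimal_model U P X \<in> edb_models U P X"
    and "S \<in> edb_models U P X \<Longrightarrow> minimal_model U P X \<subseteq> S"
    using I by auto
qed

section \<open>Induction on the strata\<close>

text \<open>These are the only predicates that can be non-empty in stage \<open>i\<close> when the
  input is id(U).\<close>

definition heads_below :: "('p, 'c, 'v) program list \<Rightarrow> nat \<Rightarrow> 'p pred set" where
  "heads_below Ps i = insert EqP (\<Union>j<i. head_preds (Ps ! j))"

lemma heads_below_Suc: "heads_below Ps (Suc i) = heads_below Ps i \<union> head_preds (Ps ! i)"
  by (auto simp: heads_below_def lessThan_Suc)

lemma heads_below_mono: "i \<le> j \<Longrightarrow> heads_below Ps i \<subseteq> heads_below Ps j"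
  by (auto simp: heads_below_def)

lemma heads_below_length: "heads_below Ps (length Ps) = insert EqP (head_preds (\<Union>(set Ps)))"
  by (fastforce simp: heads_below_def head_preds_def in_set_conv_nth)

section \<open>The stages of a fixed stratified program\<close>

context
  fixes Ps :: "('p, 'c, 'v) program list" and U :: "'c set"
  assumes strat: "stratified Ps" and univ: "universe U (\<Union>(set Ps))"
begin

abbreviation (input) "prog \<equiv> \<Union>(set Ps)"
abbreviation (input) "stg i \<equiv> stage U Ps (id_atoms U) i"
abbreviation (input) "minm i \<equiv> minimal_model U (Ps ! i) (stg i)"

lemma basic_stratum: "i < length Ps \<Longrightarrow> basic_datalog (Ps ! i)"
  using strat by (simp add: stratified_def)

lemma stratum_datalog: "i < length Ps \<Longrightarrow> \<forall>r\<in>Ps ! i. datalog_rule r"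
  using basic_stratum by (simp add: basic_datalog_def)

lemma datalog: "\<forall>r\<in>prog. datalog_rule r"
  using strat by (auto simp: stratified_def basic_datalog_def)

lemma consts_prog: "consts_of prog \<subseteq> U"
  using univ by (simp add: universe_def)

lemma stratum_consts: "i < length Ps \<Longrightarrow> consts_of (Ps ! i) \<subseteq> U"
  using consts_prog nth_mem[of i Ps] by (fastforce simp: consts_of_def prog_atoms_def)

lemma EqP_notin_heads: "i < length Ps \<Longrightarrow> EqP \<notin> head_preds (Ps ! i)"
  using EqP_not_head stratum_datalog by blast

lemma head_in_prog: "i < length Ps \<Longrightarrow> q \<in> head_preds (Ps ! i) \<Longrightarrow> q \<in> head_preds prog"
  using nth_mem[of i Ps] by (fastforce simp: head_preds_def)

lemma head_unique:
  assumes "i < length Ps" "j < length Ps" "q \<in> head_preds (Ps ! i)" "q \<in> head_preds (Ps ! j)"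
  shows "i = j"
  using strat head_in_prog[OF assms(1,3)] assms unfolding stratified_def by blast

text \<open>A head predicate that is extensional in stratum \<open>i\<close> is defined earlier, by
  stratification. The last hypothesis excludes predicates other than equality that head no rule;
  these are empty in every stage.\<close>

lemma edb_in_below:
  assumes "i < length Ps" "q \<in> edb (Ps ! i)" "q \<in> insert EqP (head_preds prog)"
  shows "q \<in> heads_below Ps i"
proof (cases "q = EqP")
  case False
  then obtain j where "j < length Ps" "q \<in> head_preds (Ps ! j)"
    using assms(3) by (fastforce simp: head_preds_def in_set_conv_nth)
  moreover from this have "j < i" using strat assms(1,2) unfolding stratified_def by blast
  ultimately show ?thesis by (auto simp: heads_below_def)
qed (simp add: heads_below_def)

lemma head_notin_below:
  assumes "i < length Ps" "q \<in> head_preds (Ps ! i)"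
  shows "q \<notin> heads_below Ps i"
proof
  assume "q \<in> heads_below Ps i"
  then obtain j where "j < i" "q \<in> head_preds (Ps ! j)"
    using assms EqP_notin_heads by (auto simp: heads_below_def)
  then show False using head_unique[of j i] assms by auto
qed

lemma stage_struct:
  "i \<le> length Ps \<Longrightarrow> stg i \<subseteq> atoms_over (heads_below Ps i) U \<and> restrict_struct (stg i) {EqP} = id_atoms U"
proof (induction i)
  case 0
  show ?case by (auto simp: id_atoms_def atoms_over_def heads_below_def restrict_struct_def)
next
  case (Suc i)
  then have i: "i < length Ps" and sub: "stg i \<subseteq> atoms_over (heads_below Ps i) U"
    and eq: "restrict_struct (stg i) {EqP} = id_atoms U" by auto
  have "minm i \<in> edb_models U (Ps ! i) (stg i)"
    using sub by (intro minimal_model_least(1) basic_stratum stratum_consts i eq) (auto simp: atoms_over_def)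
  then have m: "minm i \<subseteq> atoms_over (insert EqP (preds (Ps ! i))) U"
    "restrict_struct (minm i) (edb (Ps ! i)) = restrict_struct (stg i) (edb (Ps ! i))"
    by (simp_all add: edb_models_iff[OF basic_stratum[OF i] stratum_consts[OF i] eq])
  have e: "a \<in> minm i \<longleftrightarrow> a \<in> stg i" if "pred_of a \<in> edb (Ps ! i)" for a
    using restrict_structD[OF m(2) that] .
  \<comment> \<open>Agreement with the stage on \<open>edb\<close> leaves only the head predicates
    of the stratum for new atoms.\<close>
  have "minm i \<subseteq> stg i \<union> atoms_over (head_preds (Ps ! i)) U"
    using m(1) e edb_Un_head[of "Ps ! i"] by (fastforce simp: atoms_over_def)
  then have "stg (Suc i) \<subseteq> atoms_over (heads_below Ps (Suc i)) U"
    using sub by (auto simp: heads_below_Suc atoms_over_def)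
  moreover have "restrict_struct (stg (Suc i)) {EqP} = id_atoms U"
  proof -
    have "restrict_struct (stg (Suc i)) {EqP} = restrict_struct (stg i) {EqP}"
      using e by (auto simp: restrict_struct_def edb_def)
    then show ?thesis using eq by simp
  qed
  ultimately show ?case by blast
qed

context
  fixes i assumes i: "i < length Ps"
begin

lemmas stratum_models_iff = edb_models_iff[OF basic_stratum[OF i] stratum_consts[OF i]]

lemma stage_edb: "restrict_struct (stg i) {EqP} = id_atoms U"
  using stage_struct[of i] i by simp

lemma minm_least:
  "minm i \<in> edb_models U (Ps ! i) (stg i)"
  "S \<in> edb_models U (Ps ! i) (stg i) \<Longrightarrow> minm i \<subseteq> S"
proof -
  have X: "stg i \<subseteq> atoms_over UNIV U" using stage_struct[of i] i by (auto simp: atoms_over_def)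
  show "minm i \<in> edb_models U (Ps ! i) (stg i)"
    "S \<in> edb_models U (Ps ! i) (stg i) \<Longrightarrow> minm i \<subseteq> S"
    using minimal_model_least[OF basic_stratum[OF i] stratum_consts[OF i] stage_edb X] by auto
qed

lemma minm_over: "minm i \<subseteq> atoms_over (insert EqP (preds (Ps ! i))) U"
  and minm_edb: "pred_of a \<in> edb (Ps ! i) \<Longrightarrow> a \<in> minm i \<longleftrightarrow> a \<in> stg i"
  and minm_closed: "closed_under U (Ps ! i) (minm i) (minm i)"
  using minm_least(1) restrict_structD[of "minm i" "edb (Ps ! i)" "stg i" a]
  by (simp_all add: stratum_models_iff[OF stage_edb])

end

text \<open>Later strata never touch a settled predicate: it heads no rule of stratum
  \<open>m\<close>, so it is extensional there, where the minimal model agrees with the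
  stage.\<close>

lemma stage_restrict:
  assumes "i \<le> j" "j \<le> length Ps"
  shows "restrict_struct (stg j) (heads_below Ps i) = stg i"
  using assms
proof (induction j rule: dec_induct)
  case base
  then show ?case using stage_struct[of i] by (auto simp: restrict_struct_def atoms_over_def)
next
  case (step m)
  have m: "m < length Ps" using step by simp
  have "a \<in> stg m" if "a \<in> minm m" "pred_of a \<in> heads_below Ps i" for a
  proof -
    have "pred_of a \<notin> head_preds (Ps ! m)"
      using that head_notin_below[OF m] heads_below_mono[OF step(1)] by blast
    then have "pred_of a \<in> edb (Ps ! m)"
      using that(1) minm_over[OF m] edb_Un_head[of "Ps ! m"] by (auto simp: atoms_over_def)
    then show ?thesis using that(1) minm_edb[OF m] by blast
  qed
  then have "restrict_struct (stg (Suc m)) (heads_below Ps i) = restrict_struct (stg m) (heads_below Ps i)"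
    by (auto simp: restrict_struct_def)
  then show ?case using step by simp
qed

section \<open>The last stage yields an open answer set\<close>

abbreviation (input) "L \<equiv> stg (length Ps)"

lemma stage_subset_last: "i \<le> length Ps \<Longrightarrow> stg i \<subseteq> L"
  using stage_restrict[of i "length Ps"] by (auto simp: restrict_struct_def)

lemma last_edb_iff:
  assumes i: "i < length Ps" and q: "pred_of a \<in> edb (Ps ! i)"
  shows "a \<in> L \<longleftrightarrow> a \<in> stg i"
proof
  assume a: "a \<in> L"
  then have "pred_of a \<in> heads_below Ps i"
    using stage_struct[of "length Ps"] edb_in_below[OF i q] by (auto simp: atoms_over_def heads_below_length)
  then show "a \<in> stg i"
    using a stage_restrict[of i "length Ps"] i by (auto simp: restrict_struct_def)
qed (use stage_subset_last[of i] i in auto)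

text \<open>Extensional predicates are settled before stratum \<open>i\<close>. Atoms with a head
  predicate of the stratum are absent from stage \<open>i\<close>, enter only through its minimal
  model, and are not affected later.\<close>

lemma last_iff_minm:
  assumes i: "i < length Ps" and q: "pred_of a \<in> preds (Ps ! i)"
  shows "a \<in> L \<longleftrightarrow> a \<in> minm i"
proof (cases "pred_of a \<in> edb (Ps ! i)")
  case True
  then show ?thesis using last_edb_iff[OF i] minm_edb[OF i] by simp
next
  case False
  then have h: "pred_of a \<in> head_preds (Ps ! i)" using q by (auto simp: edb_def)
  then have "a \<notin> stg i"
    using head_notin_below[OF i] stage_struct[of i] i by (auto simp: atoms_over_def)
  moreover have "pred_of a \<in> heads_below Ps (Suc i)" using h by (simp add: heads_below_Suc)
  then have "a \<in> L \<longleftrightarrow> a \<in> stg (Suc i)"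
    using stage_restrict[of "Suc i" "length Ps"] i by (auto simp: restrict_struct_def)
  ultimately show ?thesis by simp
qed

text \<open>Each ground rule belongs to a stratum, and on the predicates of that stratum
  \<open>L\<close> coincides with its minimal model, where the rule holds.\<close>

lemma last_closed: "closed_under U prog L L"
  unfolding closed_under_def
proof (intro ballI allI impI)
  fix r a assume "r \<in> ground U prog" and f: "fires U L L r" and a: "Pos a \<in> head r"
  then obtain i where i: "i < length Ps" and r: "r \<in> ground U (Ps ! i)"
    by (auto simp: ground_Union)
  have "fires U (minm i) (minm i) r"
  proof (rule fires_transfer[OF basic_stratum[OF i] stratum_consts[OF i] r f])
    show "sat (minm i) a" if "pred_of a \<in> preds (Ps ! i)" "sat L a" for a
      using that last_iff_minm[OF i] by (cases a) auto
    show "sat L a \<longleftrightarrow> sat (minm i) a" if "pred_of a \<in> edb (Ps ! i)" for a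
      using that last_edb_iff[OF i] minm_edb[OF i] by (intro sat_cong) auto
  qed
  then have "a \<in> minm i" using minm_closed[OF i] r a by (auto simp: closed_under_def)
  then show "a \<in> L" using stage_subset_last[of "Suc i"] i by auto
qed

lemma last_minimal:
  assumes J: "closed_under U prog L J" "J \<subseteq> L" and i: "i \<le> length Ps"
  shows "stg i \<subseteq> J \<union> id_atoms U"
  using i
proof (induction i)
  case (Suc i)
  then have i: "i < length Ps" and IH: "stg i \<subseteq> J \<union> id_atoms U" by auto
  let ?H = "head_preds (Ps ! i)" and ?E = "edb (Ps ! i)"
  \<comment> \<open>Gluing the stage on extensional predicates to \<open>J\<close> on head
    predicates gives a competitor of \<open>minm i\<close>.\<close>
  let ?S = "restrict_struct (stg i) ?E \<union> restrict_struct J ?H"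
  have L: "L \<subseteq> atoms_over UNIV U" using stage_struct[of "length Ps"] by (auto simp: atoms_over_def)
  have "?E \<inter> ?H = {}" using EqP_notin_heads[OF i] by (auto simp: edb_def)
  then have edb: "restrict_struct ?S ?E = restrict_struct (stg i) ?E"
    by (auto simp: restrict_struct_def)
  have "closed_under U (Ps ! i) ?S ?S"
    unfolding closed_under_def
  proof (intro ballI allI impI)
    fix r a assume r: "r \<in> ground U (Ps ! i)" and f: "fires U ?S ?S r" and a: "Pos a \<in> head r"
    \<comment> \<open>On extensional predicates \<open>?S\<close> agrees with \<open>L\<close>, so
      closure of \<open>J\<close> relative to \<open>L\<close> becomes applicable.\<close>
    have "fires U L J r"
    proof (rule fires_transfer[OF basic_stratum[OF i] stratum_consts[OF i] r f])
      show "sat J b" if "sat ?S b" for b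
      proof -
        have "sat (J \<union> id_atoms U) b"
          by (rule sat_mono[OF that]) (use IH in \<open>auto simp: restrict_struct_def\<close>)
        then show ?thesis by simp
      qed
      show "sat ?S b \<longleftrightarrow> sat L b" if "pred_of b \<in> ?E" for b
        using last_edb_iff[OF i that] restrict_structD[OF edb that] by (intro sat_cong) blast
    qed
    then have "a \<in> J" using J(1) i r a by (auto simp: closed_under_def ground_Union)
    moreover have "pred_of a \<in> ?H"
    proof -
      obtain p ts where "head r = {Pos (Reg p ts)}" "Reg p ts \<in> atoms_over ?H U"
        using ground_head[OF r stratum_consts[OF i] stratum_datalog[OF i]] .
      then show ?thesis using a by (auto simp: atoms_over_def)
    qed
    ultimately show "a \<in> ?S" by (simp add: restrict_struct_def)
  qed
  moreover have "?S \<subseteq> atoms_over (insert EqP (preds (Ps ! i))) U"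
  proof
    fix a assume "a \<in> ?S"
    then have "a \<in> L" "pred_of a \<in> ?E \<union> ?H"
      using J(2) stage_subset_last[of i] i by (auto simp: restrict_struct_def)
    then show "a \<in> atoms_over (insert EqP (preds (Ps ! i))) U"
      using L unfolding edb_Un_head by (auto simp: atoms_over_def)
  qed
  ultimately have "minm i \<subseteq> ?S"
    using minm_least(2)[OF i] edb by (simp add: stratum_models_iff[OF i stage_edb[OF i]])
  also have "?S \<subseteq> J \<union> id_atoms U" using IH by (auto simp: restrict_struct_def)
  finally show ?case using IH by simp
qed simp

lemma answer_set_iff:
  "answer_set M (geli_reduct U M (ground U prog)) \<longleftrightarrow>
     closed_under U prog M M \<and> (\<forall>J. J \<subset> M \<longrightarrow> \<not> closed_under U prog M J)"
  by (simp add: answer_set_def is_model_reduct_iff[OF consts_prog datalog])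

text \<open>Removing id(U) takes away no head, since heads are regular atoms, and keeps the truth of
  all bodies.\<close>

lemma closed_under_diff_id_atoms:
  assumes "closed_under U prog M J"
  shows "closed_under U prog M (J - id_atoms U)"
  unfolding closed_under_def
proof (intro ballI allI impI)
  fix r a assume r: "r \<in> ground U prog" and f: "fires U M (J - id_atoms U) r" and a: "Pos a \<in> head r"
  obtain p ts where "head r = {Pos (Reg p ts)}" using ground_head[OF r consts_prog datalog] .
  then have "a \<notin> id_atoms U" using a by (auto simp: id_atoms_def)
  moreover have "fires U M J r" using f fires_sat_cong[of M M "J - id_atoms U" J] by simp
  then have "a \<in> J" using assms r a by (auto simp: closed_under_def)
  ultimately show "a \<in> J - id_atoms U" by blast
qed

lemma closed_under_sat_cong: "sat M = sat M' \<Longrightarrow> closed_under U P M J = closed_under U P M' J"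
  using fires_sat_cong[of M M' J J] by (simp add: closed_under_def)

lemma open_answer_set_last: "open_answer_set prog U (L - id_atoms U)"
proof -
  let ?M = "L - id_atoms U"
  have L: "L \<subseteq> atoms_over (insert EqP (head_preds prog)) U" "restrict_struct L {EqP} = id_atoms U"
    using stage_struct[of "length Ps"] by (auto simp: heads_below_length)
  have "?M \<subseteq> atoms_over (preds prog - {EqP}) U"
    using L head_preds_subset[of prog] by (fastforce simp: atoms_over_def restrict_struct_def)
  moreover have "closed_under U prog ?M ?M"
    using closed_under_diff_id_atoms[OF last_closed] by (simp add: closed_under_sat_cong[of ?M L])
  \<comment> \<open>At the last stage \<open>last_minimal\<close> puts \<open>L\<close> inside
    \<open>J\<close> together with id(U), so \<open>J\<close> cannot miss an element of
    \<open>?M\<close>.\<close>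
  moreover have "\<not> closed_under U prog ?M J" if "J \<subset> ?M" for J
    using last_minimal[of J "length Ps"] that by (auto simp: closed_under_sat_cong[of ?M L])
  ultimately show ?thesis using univ by (simp add: open_answer_set_def answer_set_iff)
qed

section \<open>Uniqueness of the open answer set\<close>

context
  fixes M assumes M: "open_answer_set prog U M"
begin

lemma M_over: "M \<subseteq> atoms_over (preds prog - {EqP}) U"
  and M_closed: "closed_under U prog M M"
  and M_minimal: "J \<subseteq> M \<Longrightarrow> closed_under U prog M J \<Longrightarrow> J = M"
  using M by (auto simp: open_answer_set_def answer_set_iff)

text \<open>Cutting \<open>M\<close> down to atoms with head predicates leaves it closed, so by
  minimality nothing is cut. Regular predicates that head no rule are thus empty in
  \<open>M\<close>, matching the input id(U).\<close>

lemma M_heads: "M \<subseteq> atoms_over (head_preds prog) U"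
proof -
  have "closed_under U prog M (M \<inter> atoms_over (head_preds prog) U)" (is "closed_under U prog M ?J")
    unfolding closed_under_def
  proof (intro ballI allI impI)
    fix r a assume r: "r \<in> ground U prog" and f: "fires U M ?J r" and a: "Pos a \<in> head r"
    have "fires U M M r" using f sat_mono[of ?J _ M] by (auto simp: fires_def)
    then have "a \<in> M" using M_closed r a by (auto simp: closed_under_def)
    moreover obtain p ts where "head r = {Pos (Reg p ts)}" "Reg p ts \<in> atoms_over (head_preds prog) U"
      using ground_head[OF r consts_prog datalog] .
    then have "a \<in> atoms_over (head_preds prog) U" using a by simp
    ultimately show "a \<in> ?J" by blast
  qed
  from M_minimal[OF _ this] show ?thesis by blast
qed

lemma answer_set_stratum_least:
  assumes i: "i < length Ps"
    and IH: "restrict_struct (M \<union> id_atoms U) (heads_below Ps i) = stg i"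
  defines "S \<equiv> restrict_struct (M \<union> id_atoms U) (insert EqP (preds (Ps ! i)))"
  shows "minm i = S"
proof (rule minimal_model_eqI)
  let ?H = "head_preds (Ps ! i)" and ?E = "edb (Ps ! i)"
  note iff = stratum_models_iff[OF i stage_edb[OF i]]
  have edb: "a \<in> M \<union> id_atoms U \<longleftrightarrow> a \<in> stg i" if "pred_of a \<in> ?E" for a
  proof -
    \<comment> \<open>By \<open>M_heads\<close> a regular atom of \<open>M\<close> has a head
      predicate; being extensional in stratum \<open>i\<close>, it is defined earlier, where
      \<open>IH\<close> identifies \<open>M\<close> with the stage.\<close>
    have "pred_of a \<in> heads_below Ps i" if "a \<in> M \<union> id_atoms U"
      using that M_heads edb_in_below[OF i \<open>pred_of a \<in> ?E\<close>]
      by (auto simp: atoms_over_def id_atoms_def)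
    then show ?thesis unfolding IH[symmetric] by (auto simp: restrict_struct_def)
  qed
  have satS: "sat S a \<longleftrightarrow> sat M a" if "pred_of a \<in> insert EqP (preds (Ps ! i))" for a
    using that by (cases a) (auto simp: S_def restrict_struct_def id_atoms_def)
  have closed: "closed_under U (Ps ! i) S S"
    unfolding closed_under_def
  proof (intro ballI allI impI)
    fix r a assume r: "r \<in> ground U (Ps ! i)" and f: "fires U S S r" and a: "Pos a \<in> head r"
    have "fires U M M r"
      by (rule fires_transfer[OF basic_stratum[OF i] stratum_consts[OF i] r f])
        (use satS edb_Un_head[of "Ps ! i"] in auto)
    then have "a \<in> M" using M_closed i r a by (auto simp: closed_under_def ground_Union)
    moreover obtain p ts where "head r = {Pos (Reg p ts)}" "Reg p ts \<in> atoms_over ?H U"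
      using ground_head[OF r stratum_consts[OF i] stratum_datalog[OF i]] .
    then have "pred_of a \<in> preds (Ps ! i)"
      using a head_preds_subset[of "Ps ! i"] by (auto simp: atoms_over_def)
    ultimately show "a \<in> S" by (simp add: S_def restrict_struct_def)
  qed
  have "restrict_struct S ?E = restrict_struct (stg i) ?E"
    using edb edb_Un_head[of "Ps ! i"] by (auto simp: S_def restrict_struct_def)
  moreover have "S \<subseteq> atoms_over (insert EqP (preds (Ps ! i))) U"
    using M_over by (auto simp: S_def restrict_struct_def atoms_over_def id_atoms_def)
  ultimately show "S \<in> edb_models U (Ps ! i) (stg i)" using closed by (simp add: iff)
  fix S' assume "S' \<in> edb_models U (Ps ! i) (stg i)"
  then have S': "restrict_struct S' ?E = restrict_struct (stg i) ?E" "closed_under U (Ps ! i) S' S'"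
    by (auto simp: iff)
  have edb': "a \<in> S' \<longleftrightarrow> a \<in> M \<union> id_atoms U" if "pred_of a \<in> ?E" for a
    using edb[OF that] restrict_structD[OF S'(1) that] by simp
  \<comment> \<open>This drops from \<open>M\<close> the head atoms of stratum \<open>i\<close> that
    are false in the competitor \<open>S'\<close>. Once it is shown closed, minimality of
    \<open>M\<close> leaves nothing to drop.\<close>
  let ?J = "{a \<in> M. pred_of a \<in> ?H \<longrightarrow> a \<in> S'}"
  have "closed_under U prog M ?J"
    unfolding closed_under_def
  proof (intro ballI allI impI)
    fix r a assume r: "r \<in> ground U prog" and f: "fires U M ?J r" and a: "Pos a \<in> head r"
    have "fires U M M r" using f sat_mono[of ?J _ M] by (auto simp: fires_def)
    then have "a \<in> M" using M_closed r a by (auto simp: closed_under_def)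
    moreover have "a \<in> S'" if h: "pred_of a \<in> ?H"
    proof -
      obtain k where k: "k < length Ps" "r \<in> ground U (Ps ! k)" using r by (auto simp: ground_Union)
      obtain p ts where "head r = {Pos (Reg p ts)}" "Reg p ts \<in> atoms_over (head_preds (Ps ! k)) U"
        using ground_head[OF k(2) stratum_consts[OF k(1)] stratum_datalog[OF k(1)]] .
      then have "pred_of a \<in> head_preds (Ps ! k)" using a by (auto simp: atoms_over_def)
      \<comment> \<open>A head predicate has only one defining stratum, so the rule is one that
        \<open>S'\<close> is closed under.\<close>
      then have r: "r \<in> ground U (Ps ! i)" using head_unique[OF k(1) i _ h] k by simp
      have "fires U S' S' r"
      proof (rule fires_transfer[OF basic_stratum[OF i] stratum_consts[OF i] r f])
        \<comment> \<open>Regular atoms with a head predicate pass by the choice of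
          \<open>?J\<close>, those with an extensional predicate by \<open>edb'\<close>.\<close>
        show "sat S' b" if "pred_of b \<in> preds (Ps ! i)" "sat ?J b" for b
          using that edb'[of b] by (cases b) (auto simp: edb_def)
        show "sat M b \<longleftrightarrow> sat S' b" if "pred_of b \<in> ?E" for b
          using edb'[OF that] by (cases b) (auto simp: id_atoms_def)
      qed
      then show ?thesis using S'(2) r a by (auto simp: closed_under_def)
    qed
    ultimately show "a \<in> ?J" by blast
  qed
  then have J: "?J = M" using M_minimal[of ?J] by blast
  show "S \<subseteq> S'"
  proof
    fix a assume "a \<in> S"
    then have a: "a \<in> M \<union> id_atoms U" "pred_of a \<in> ?E \<union> ?H"
      by (auto simp: S_def restrict_struct_def edb_Un_head)
    show "a \<in> S'"
    proof (cases "pred_of a \<in> ?E")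
      case True
      then show ?thesis using a edb' by blast
    next
      case False
      then have "a \<in> M" using a by (auto simp: id_atoms_def edb_def)
      then show ?thesis using J a False by blast
    qed
  qed
qed

lemma answer_set_stage:
  "i \<le> length Ps \<Longrightarrow> restrict_struct (M \<union> id_atoms U) (heads_below Ps i) = stg i"
proof (induction i)
  case 0
  show ?case using M_over
    by (auto simp: restrict_struct_def heads_below_def atoms_over_def id_atoms_def)
next
  case (Suc i)
  then have i: "i < length Ps"
    and IH: "restrict_struct (M \<union> id_atoms U) (heads_below Ps i) = stg i" by auto
  \<comment> \<open>On these atoms the extensional predicates of the stratum already lie below
    \<open>i\<close>. Adding its head predicates thus has the same effect as adding all its
    predicates, and the split matches the recursion of \<open>stage\<close>.\<close>
  have "pred_of a \<in> heads_below Ps (Suc i) \<longleftrightarrow>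
      pred_of a \<in> heads_below Ps i \<or> pred_of a \<in> insert EqP (preds (Ps ! i))"
    if "a \<in> M \<union> id_atoms U" for a
  proof -
    have "pred_of a \<in> insert EqP (head_preds prog)"
      using that M_heads by (auto simp: atoms_over_def id_atoms_def)
    then show ?thesis
      using edb_in_below[OF i] unfolding edb_Un_head[symmetric] heads_below_Suc by blast
  qed
  then have "restrict_struct (M \<union> id_atoms U) (heads_below Ps (Suc i)) =
      restrict_struct (M \<union> id_atoms U) (heads_below Ps i) \<union>
      restrict_struct (M \<union> id_atoms U) (insert EqP (preds (Ps ! i)))"
    unfolding restrict_struct_def by blast
  then show ?case by (simp add: IH answer_set_stratum_least[OF i IH])
qed

lemma answer_set_eq_last: "M = L - id_atoms U"
proof -
  have "L = M \<union> id_atoms U"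
    unfolding answer_set_stage[OF order_refl, symmetric] using M_heads
    by (auto simp: restrict_struct_def heads_below_length atoms_over_def id_atoms_def)
  moreover have "M \<inter> id_atoms U = {}"
    using M_over by (auto simp: atoms_over_def id_atoms_def)
  ultimately show ?thesis by blast
qed

end

section \<open>Truth of ground literals in the last stage\<close>

lemma holds_last_iff:
  assumes "lit_atom l \<in> atoms_over (insert EqP (preds prog)) U"
  shows "holds L l \<longleftrightarrow> sat_lit (L - id_atoms U) l"
  using mem_iff_sat[of L U "lit_atom l"] stage_struct[of "length Ps"] assms
  by (cases l) (auto simp: atoms_over_def)

end

theorem theorem8p5:
  fixes Ps :: "('p, 'c, 'v) program list" and U :: "'c set"
  assumes "stratified Ps"
    and "universe U (\<Union>(set Ps))"
  shows "(\<forall>l. lit_atom l \<in> atoms_over (insert EqP (preds (\<Union>(set Ps)))) U \<longrightarrow>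
            (holds (lfp_model U Ps (id_atoms U)) l \<longleftrightarrow>
             (\<exists>M. open_answer_set (\<Union>(set Ps)) U M \<and> sat_lit M l))) \<and>
         (\<forall>M. open_answer_set (\<Union>(set Ps)) U M \<longrightarrow>
            M = lfp_model U Ps (id_atoms U) - id_atoms U)"
  unfolding lfp_model_def
proof (intro conjI allI impI iffI)
  let ?P = "\<Union>(set Ps)" and ?L = "stage U Ps (id_atoms U) (length Ps)"
  show "M = ?L - id_atoms U" if "open_answer_set ?P U M" for M
    using answer_set_eq_last[OF assms that] .
  fix l :: "('p, 'c, 'v) lit"
  assume l: "lit_atom l \<in> atoms_over (insert EqP (preds ?P)) U"
  note holds = holds_last_iff[OF assms l]
  show "\<exists>M. open_answer_set ?P U M \<and> sat_lit M l" if "holds ?L l"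
    using open_answer_set_last[OF assms] that holds by blast
  \<comment> \<open>By uniqueness any witness is \<open>?L\<close> without id(U), so its truth value
    for \<open>l\<close> is that of \<open>?L\<close>.\<close>
  show "holds ?L l" if "\<exists>M. open_answer_set ?P U M \<and> sat_lit M l"
    using answer_set_eq_last[OF assms] that holds by blast
qed

end
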